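(* $\Sigma(\mathrm{NLIM}_{\mathbb N})\not\leq_{\mathrm W}\mathrm{WKL}$.
   Context: A represented space is a set $X$ with a partial surjective map $\delta_X:\subseteq\mathbb N^{\mathbb N}\to X$. A problem is a partial multi-valued function $f:\subseteq X\rightrightarrows Y$ between represented spaces that has a realizer; a realizer of $f$ is a function $F:\subseteq\mathbb N^{\mathbb N}\to\mathbb N^{\mathbb N}$ with $\delta_YF(p)\in f\delta_X(p)$ for all $p\in\mathrm{dom}(f\delta_X)$. For $p,q\in\mathbb N^{\mathbb N}$, $\langle p,q\rangle(2n)=p(n)$, $\langle p,q\rangle(2n+1)=q(n)$. For problems $f,g$: $f\leq_{\mathrm W}g$ if there are computable $H,K:\subseteq\mathbb N^{\mathbb N}\to\mathbb N^{\mathbb N}$ such that $H\langle\mathrm{id},GK\rangle$ is a realizer of $f$ whenever $G$ is a realizer of $g$. For a represented space $Y$, the completion $\overline Y:=Y\cup\{\bot\}$ ($\bot\notin Y$) is represented by the total map $\delta_{\overline Y}$ with $\delta_{\overline Y}(p)=\delta_Y(p-1)$ if $p-1\in\mathrm{dom}(\delta_Y)$ and $\delta_{\overline Y}(p)=\bot$ otherwise, where $p-1\in\mathbb N^{\mathbb N}\cup\mathbb N^*$ is the concatenation of $p(0)-1,p(1)-1,\dots$ and $0-1$ is the empty word. $\mathbb N^{\mathbb N}$ and $2^{\mathbb N}$ are represented by (restrictions of) the identity, $\mathbb N$ by $p\mapsto p(0)$, and $X^{\mathbb N}$ by $\langle p_0,p_1,\dots\rangle\mapsto(\delta_X(p_n))_n$,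 where $\langle p_0,p_1,\dots\rangle\langle n,k\rangle:=p_n(k)$ and $\langle n,k\rangle:=\frac12(n+k)(n+k+1)+k$ for $n,k\in\mathbb N$. Stashing: for $f:\subseteq X\rightrightarrows Y$, $\Sigma f:\subseteq X^{\mathbb N}\rightrightarrows\overline Y^{\mathbb N}$ has domain $\mathrm{dom}(f)^{\mathbb N}$ and $\Sigma f((x_n)_n)=\{(y_n)_n\in\overline Y^{\mathbb N}:(\exists n)\ y_n\in f(x_n)\}$. The limit avoidance problem is $\mathrm{NLIM}_{\mathbb N}:\subseteq\mathbb N^{\mathbb N}\rightrightarrows\mathbb N$, $p\mapsto\{k\in\mathbb N:\lim_{n\to\infty}p(n)\neq k\}$, with domain the set of all $p$ for which $(p(n))_n$ converges (in the discrete space $\mathbb N$). $\mathrm{WKL}:\subseteq\mathrm{Tr}\rightrightarrows2^{\mathbb N}$, $T\mapsto[T]$, with domain the set of infinite trees, where $\mathrm{Tr}$ is the set of binary trees $T\subseteq\{0,1\}^*$ (represented by characteristic functions) and $[T]$ is the set of infinite paths of $T$. *)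

theory Defs
  imports Complex_Main "HOL-Library.Infinite_Set" "HOL-Library.Nat_Bijection"
begin

type_synonym baire = "nat \<Rightarrow> nat"

section \<open>Computable partial functions on Baire space\<close>

text \<open>Kleene's partial recursive functions with an oracle. The oracle is not part of the
  program, so a program denotes a Turing functional.\<close>

datatype recf =
    Zero
  | Succ
  | Proj nat
  | Oracle
  | Comp recf "recf list"
  | PrimRec recf recf
  | Mu recf

inductive eval :: "baire \<Rightarrow> recf \<Rightarrow> nat list \<Rightarrow> nat \<Rightarrow> bool" for p :: baire where
  Zero: "eval p Zero xs 0"
| Succ: "eval p Succ [x] (Suc x)"
| Proj: "i < length xs \<Longrightarrow> eval p (Proj i) xs (xs ! i)"
| Oracle: "eval p Oracle [x] (p x)"
| Comp: "list_all2 (\<lambda>g y. eval p g xs y) gs ys \<Longrightarrow> eval p f ys z \<Longrightarrow> eval p (Comp f gs) xs z"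
| PrimRec_0: "eval p f xs y \<Longrightarrow> eval p (PrimRec f g) (0 # xs) y"
| PrimRec_Suc: "eval p (PrimRec f g) (n # xs) y \<Longrightarrow> eval p g (n # y # xs) z
    \<Longrightarrow> eval p (PrimRec f g) (Suc n # xs) z"
| Mu: "eval p f (n # xs) 0 \<Longrightarrow> (\<forall>m<n. \<exists>y. eval p f (m # xs) (Suc y)) \<Longrightarrow> eval p (Mu f) xs n"

text \<open>As usual in computable analysis, nothing is required of the program on oracles outside
  the domain of \<open>F\<close>.\<close>

definition computable :: "(baire \<rightharpoonup> baire) \<Rightarrow> bool" where
  "computable F \<longleftrightarrow> (\<exists>e. \<forall>p q. F p = Some q \<longrightarrow> (\<forall>n. eval p e [n] (q n)))"

section \<open>Represented spaces and problems\<close>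

text \<open>A represented space is given by its representation; the underlying set is the range of
  that partial map, which makes surjectivity automatic.\<close>

type_synonym 'a rep = "baire \<rightharpoonup> 'a"

abbreviation carrier :: "'a rep \<Rightarrow> 'a set" where
  "carrier \<delta> \<equiv> ran \<delta>"

text \<open>A partial multi-valued function between represented spaces; it is undefined at the
  points where its value is the empty set.\<close>

record ('a, 'b) mvfun =
  src :: "'a rep"
  tgt :: "'b rep"
  val :: "'a \<Rightarrow> 'b set"

definition mdom :: "('a, 'b) mvfun \<Rightarrow> 'a set" where
  "mdom f = {x \<in> carrier (src f). val f x \<noteq> {}}"

definition realizer :: "(baire \<rightharpoonup> baire) \<Rightarrow> ('a, 'b) mvfun \<Rightarrow> bool" where
  "realizer F f \<longleftrightarrow> (\<forall>p x. src f p = Some x \<and> x \<in> mdom f \<longrightarrow>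
     (\<exists>q y. F p = Some q \<and> tgt f q = Some y \<and> y \<in> val f x))"

definition problem :: "('a, 'b) mvfun \<Rightarrow> bool" where
  "problem f \<longleftrightarrow> (\<forall>x. val f x \<noteq> {} \<longrightarrow> x \<in> carrier (src f) \<and> val f x \<subseteq> carrier (tgt f))
     \<and> (\<exists>F. realizer F f)"

definition pair :: "baire \<Rightarrow> baire \<Rightarrow> baire" where
  "pair p q n = (if even n then p (n div 2) else q (n div 2))"

definition weihrauch_le :: "('a, 'b) mvfun \<Rightarrow> ('c, 'd) mvfun \<Rightarrow> bool" (infix "\<le>\<^sub>W" 50) where
  "f \<le>\<^sub>W g \<longleftrightarrow> (\<exists>H K. computable H \<and> computable K \<and>
     (\<forall>G. realizer G g \<longrightarrow>
        realizer (H \<circ>\<^sub>m (\<lambda>p. map_option (pair p) ((G \<circ>\<^sub>m K) p))) f))"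

section \<open>Standard representations\<close>

definition rep_baire :: "baire rep" where
  "rep_baire p = Some p"

definition rep_cantor :: "baire rep" where
  "rep_cantor p = (if range p \<subseteq> {0, 1} then Some p else None)"

definition rep_nat :: "nat rep" where
  "rep_nat p = Some (p 0)"

definition cantor_pair :: "nat \<Rightarrow> nat \<Rightarrow> nat" where
  "cantor_pair n k = (n + k) * (n + k + 1) div 2 + k"

lemma cantor_pair_eq_prod_encode: "cantor_pair n k = prod_encode (k, n)"
  by (simp add: cantor_pair_def prod_encode_def triangle_def add.commute)

definition rep_seq :: "'a rep \<Rightarrow> (nat \<Rightarrow> 'a) rep" where
  "rep_seq \<delta> p =
     (if \<forall>n. (\<lambda>k. p (cantor_pair n k)) \<in> dom \<delta>
      then Some (\<lambda>n. the (\<delta> (\<lambda>k. p (cantor_pair n k)))) else None)"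

text \<open>The sequence \<open>p - 1\<close>: delete all zeros from \<open>p\<close> and decrement the remaining entries.
  The value \<open>None\<close> stands for the case that \<open>p - 1\<close> is only a finite word.\<close>

definition minus_one :: "baire \<rightharpoonup> baire" where
  "minus_one p =
     (if infinite {i. p i \<noteq> 0} then Some (\<lambda>n. p (enumerate {i. p i \<noteq> 0} n) - 1) else None)"

text \<open>The completion adds the point \<open>None\<close> as bottom element, so here the outer option
  is the (total) representation and the inner one is the completed space.\<close>

definition rep_completion :: "'a rep \<Rightarrow> 'a option rep" where
  "rep_completion \<delta> p =
     Some (case minus_one p of None \<Rightarrow> None | Some q \<Rightarrow> \<delta> q)"

section \<open>Binary trees\<close>

definition words :: "nat list set" where
  "words = {w. set w \<subseteq> {0, 1}}"

text \<open>Bijective base-2 numeration of the binary words.\<close>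

fun word_code :: "nat list \<Rightarrow> nat" where
  "word_code [] = 0"
| "word_code (b # w) = 2 * word_code w + b + 1"

lemma bij_betw_word_code: "bij_betw word_code words UNIV"
proof (rule bij_betwI')
  fix v w assume "v \<in> words" "w \<in> words"
  then show "(word_code v = word_code w) = (v = w)"
  proof (induction v arbitrary: w)
    case Nil
    then show ?case by (cases w) auto
  next
    case (Cons b v)
    show ?case
    proof (cases w)
      case Nil
      then show ?thesis by simp
    next
      case w: (Cons c u)
      have bc: "b = 0 \<or> b = 1" "c = 0 \<or> c = 1" and vu: "v \<in> words" "u \<in> words"
        using Cons.prems w by (auto simp: words_def)
      have "2 * word_code v + b = 2 * word_code u + c \<longleftrightarrow> word_code v = word_code u \<and> b = c"
        using bc by presburger
      then show ?thesis using Cons.IH[OF vu] w by auto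
    qed
  qed
next
  fix n :: nat
  show "\<exists>w\<in>words. n = word_code w"
  proof (induction n rule: less_induct)
    case (less n)
    show ?case
    proof (cases "n = 0")
      case True
      then show ?thesis by (intro bexI[of _ "[]"]) (auto simp: words_def)
    next
      case False
      have "(n - 1) div 2 < n" using False by linarith
      from less.IH[OF this] obtain w where w: "w \<in> words" "(n - 1) div 2 = word_code w"
        by blast
      have "n = word_code ((n - 1) mod 2 # w)"
        using False w(2)[symmetric] by simp
      moreover have "(n - 1) mod 2 # w \<in> words"
        using w(1) by (auto simp: words_def)
      ultimately show ?thesis by blast
    qed
  qed
qed auto

definition bintree :: "nat list set \<Rightarrow> bool" where
  "bintree T \<longleftrightarrow> T \<subseteq> words \<and> (\<forall>v w. v @ w \<in> T \<longrightarrow> v \<in> T)"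

definition rep_tree :: "nat list set rep" where
  "rep_tree p =
     (let T = {w \<in> words. p (word_code w) = 1}
      in if range p \<subseteq> {0, 1} \<and> bintree T then Some T else None)"

definition paths :: "nat list set \<Rightarrow> baire set" where
  "paths T = {q. range q \<subseteq> {0, 1} \<and> (\<forall>n. map q [0..<n] \<in> T)}"

section \<open>The problems\<close>

definition WKL :: "(nat list set, baire) mvfun" where
  "WKL = \<lparr>src = rep_tree, tgt = rep_cantor,
          val = (\<lambda>T. if bintree T \<and> infinite T then paths T else {})\<rparr>"

definition NLIM :: "(baire, nat) mvfun" where
  "NLIM = \<lparr>src = rep_baire, tgt = rep_nat,
           val = (\<lambda>p. if convergent p then {k. lim p \<noteq> k} else {})\<rparr>"

definition stash :: "('a, 'b) mvfun \<Rightarrow> (nat \<Rightarrow> 'a, nat \<Rightarrow> 'b option) mvfun" where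
  "stash f =
     \<lparr>src = rep_seq (src f), tgt = rep_seq (rep_completion (tgt f)),
      val = (\<lambda>x. if \<forall>n. x n \<in> mdom f
                 then {y. (\<forall>n. y n \<in> carrier (rep_completion (tgt f))) \<and>
                          (\<exists>n. \<exists>z \<in> val f (x n). y n = Some z)}
                 else {})\<rparr>"

section \<open>The problems have the intended domains, and they are problems\<close>

lemma problemI:
  assumes "\<And>x. val f x \<noteq> {} \<Longrightarrow> x \<in> carrier (src f) \<and> val f x \<subseteq> carrier (tgt f)"
  shows "problem f"
proof -
  have "\<exists>q. \<forall>x. src f p = Some x \<and> x \<in> mdom f \<longrightarrow> (\<exists>y. tgt f q = Some y \<and> y \<in> val f x)" for p
  proof (cases "\<exists>x. src f p = Some x \<and> x \<in> mdom f")
    case True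
    then obtain x where x: "src f p = Some x" "val f x \<noteq> {}" by (auto simp: mdom_def)
    then obtain y where "y \<in> val f x" "y \<in> carrier (tgt f)" using assms by blast
    then show ?thesis using x(1) by (auto simp: ran_def)
  qed auto
  then obtain Q where
    "\<And>p x. src f p = Some x \<and> x \<in> mdom f \<Longrightarrow> \<exists>y. tgt f (Q p) = Some y \<and> y \<in> val f x"
    by metis
  then have "realizer (\<lambda>p. Some (Q p)) f"
    by (auto simp: realizer_def)
  then show ?thesis using assms unfolding problem_def by blast
qed

lemma mdom_NLIM: "mdom NLIM = {p. convergent p}"
proof -
  have "\<exists>k::nat. l \<noteq> k" for l by (rule exI[of _ "Suc l"]) simp
  then show ?thesis by (auto simp: mdom_def NLIM_def rep_baire_def ran_def)
qed

lemma problem_NLIM: "problem NLIM"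
proof -
  have "\<exists>p. rep_nat p = Some k" for k
    by (rule exI[of _ "\<lambda>_. k"]) (simp add: rep_nat_def)
  then show ?thesis
    by (intro problemI) (auto simp: NLIM_def rep_baire_def ran_def)
qed

lemma carrier_rep_seq:
  fixes \<delta> :: "'a rep"
  shows "carrier (rep_seq \<delta>) = {x. \<forall>n. x n \<in> carrier \<delta>}"
proof (intro equalityI subsetI)
  fix x assume "x \<in> carrier (rep_seq \<delta>)"
  then obtain p where p: "rep_seq \<delta> p = Some x" by (auto simp: ran_def)
  then have "\<forall>n. (\<lambda>k. p (cantor_pair n k)) \<in> dom \<delta>"
    and "x = (\<lambda>n. the (\<delta> (\<lambda>k. p (cantor_pair n k))))"
    unfolding rep_seq_def by (meson option.distinct(1), metis option.distinct(1) option.inject)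
  then have "\<delta> (\<lambda>k. p (cantor_pair n k)) = Some (x n)" for n by (simp add: domIff)
  then show "x \<in> {x. \<forall>n. x n \<in> carrier \<delta>}" by (auto intro: ranI)
next
  fix x :: "nat \<Rightarrow> 'a" assume "x \<in> {x. \<forall>n. x n \<in> carrier \<delta>}"
  then have "\<forall>n. \<exists>q. \<delta> q = Some (x n)" by (auto simp: ran_def)
  then obtain q where q: "\<And>n. \<delta> (q n) = Some (x n)" by metis
  define p where "p m = (case prod_decode m of (k, n) \<Rightarrow> q n k)" for m
  have "p (cantor_pair n k) = q n k" for n k
    by (simp add: p_def cantor_pair_eq_prod_encode)
  then have "rep_seq \<delta> p = Some x" by (auto simp: rep_seq_def q)
  then show "x \<in> carrier (rep_seq \<delta>)" by (auto simp: ran_def)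
qed

lemma carrier_rep_completion: "carrier (rep_completion \<delta>) = insert None (Some ` carrier \<delta>)"
proof (intro equalityI subsetI)
  fix x assume "x \<in> carrier (rep_completion \<delta>)"
  then show "x \<in> insert None (Some ` carrier \<delta>)"
    by (cases x) (auto simp: ran_def rep_completion_def split: option.splits)
next
  fix x assume "x \<in> insert None (Some ` carrier \<delta>)"
  then consider "x = None" | y q where "x = Some y" "\<delta> q = Some y" by (auto simp: ran_def)
  then show "x \<in> carrier (rep_completion \<delta>)"
  proof cases
    case 1
    have "rep_completion \<delta> (\<lambda>_. 0) = Some None" by (simp add: rep_completion_def minus_one_def)
    then show ?thesis using 1 by (auto simp: ran_def)
  next
    case 2
    have "enumerate UNIV n = n" for n :: nat
    proof (induction n)
      case 0
      show ?case by (simp add: enumerate_0 Least_equality)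
    next
      case (Suc n)
      show ?case by (simp add: enumerate_Suc'' Suc Least_equality Suc_leI)
    qed
    then have "minus_one (\<lambda>n. Suc (q n)) = Some q" by (simp add: minus_one_def)
    then have "rep_completion \<delta> (\<lambda>n. Suc (q n)) = Some x" using 2 by (simp add: rep_completion_def)
    then show ?thesis by (auto simp: ran_def)
  qed
qed

lemma mdom_stash:
  assumes "problem f"
  shows "mdom (stash f) = {x. \<forall>n. x n \<in> mdom f}"
proof -
  have "val (stash f) x \<noteq> {}" if x: "\<forall>n. x n \<in> mdom f" for x
  proof -
    obtain z where z: "z \<in> val f (x 0)" "z \<in> carrier (tgt f)"
      using assms x by (fastforce simp: problem_def mdom_def)
    have "(\<lambda>_. Some z) \<in> val (stash f) x"
      using x z by (auto simp: stash_def carrier_rep_completion)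
    then show ?thesis by blast
  qed
  then have *: "val (stash f) x \<noteq> {} \<longleftrightarrow> (\<forall>n. x n \<in> mdom f)" for x
    by (auto simp: stash_def split: if_splits)
  show ?thesis unfolding mdom_def[of "stash f"] *
    by (auto simp: stash_def carrier_rep_seq mdom_def)
qed

lemma problem_stash: "problem (stash f)"
proof (rule problemI)
  fix x assume "val (stash f) x \<noteq> {}"
  then have "\<forall>n. x n \<in> mdom f" by (auto simp: stash_def split: if_splits)
  then show "x \<in> carrier (src (stash f)) \<and> val (stash f) x \<subseteq> carrier (tgt (stash f))"
    by (auto simp: stash_def carrier_rep_seq mdom_def)
qed

lemma carrier_rep_tree: "carrier rep_tree = {T. bintree T}"
proof (intro equalityI subsetI)
  fix T assume "T \<in> carrier rep_tree"
  then show "T \<in> {T. bintree T}" by (auto simp: ran_def rep_tree_def Let_def split: if_splits)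
next
  fix T assume T: "T \<in> {T. bintree T}"
  define p :: baire where "p m = (if m \<in> word_code ` T then 1 else 0)" for m
  have "T \<subseteq> words" using T by (auto simp: bintree_def)
  then have "{w \<in> words. p (word_code w) = 1} = T"
    using bij_betw_word_code by (auto simp: p_def bij_betw_def inj_on_def)
  then have "rep_tree p = Some T"
    using T by (auto simp: rep_tree_def Let_def p_def)
  then show "T \<in> carrier rep_tree" by (auto simp: ran_def)
qed

lemma konig:
  assumes T: "bintree T" "infinite T"
  shows "paths T \<noteq> {}"
proof -
  define I where "I v \<longleftrightarrow> infinite {w. v @ w \<in> T}" for v
  have step: "\<exists>b\<in>{0, 1}. I (v @ [b])" if "I v" for v
  proof (rule ccontr)
    assume "\<not> ?thesis"
    then have fin: "finite {w. (v @ [b]) @ w \<in> T}" if "b \<in> {0, 1}" for b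
      using that by (auto simp: I_def)
    have "{w. v @ w \<in> T} \<subseteq> insert [] (\<Union>b\<in>{0, 1}. Cons b ` {w. (v @ [b]) @ w \<in> T})"
    proof
      fix w assume w: "w \<in> {w. v @ w \<in> T}"
      show "w \<in> insert [] (\<Union>b\<in>{0, 1}. Cons b ` {w. (v @ [b]) @ w \<in> T})"
      proof (cases w)
        case (Cons b u)
        have "v @ w \<in> words" using w T(1) by (auto simp: bintree_def)
        then have "b = 0 \<or> b = 1" using Cons by (auto simp: words_def)
        then show ?thesis using w Cons by auto
      qed simp
    qed
    moreover have "finite (insert [] (\<Union>b\<in>{0, 1}. Cons b ` {w. (v @ [b]) @ w \<in> T}))"
      using fin by blast
    ultimately show False using \<open>I v\<close> finite_subset unfolding I_def by blast
  qed
  define nxt where "nxt v = v @ [SOME b. b \<in> {0, 1} \<and> I (v @ [b])]" for v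
  define P where "P n = (nxt ^^ n) []" for n
  have nxt: "\<exists>b\<in>{0, 1}. nxt v = v @ [b] \<and> I (v @ [b])" if "I v" for v
    using someI_ex[of "\<lambda>b. b \<in> {0, 1} \<and> I (v @ [b])"] step[OF that] unfolding nxt_def by blast
  have P: "I (P n)" for n
  proof (induction n)
    case 0
    show ?case using T(2) by (simp add: P_def I_def)
  next
    case (Suc n)
    then show ?case using nxt[of "P n"] by (auto simp: P_def)
  qed
  define q where "q n = last (P (Suc n))" for n
  have PS: "P (Suc n) = P n @ [q n] \<and> q n \<in> {0, 1}" for n
    using nxt[OF P[of n]] by (auto simp: q_def P_def)
  have "P n = map q [0..<n]" for n
    by (induction n) (simp add: P_def, simp add: PS)
  moreover have "P n \<in> T" for n
  proof -
    have "{w. P n @ w \<in> T} \<noteq> {}" using P[of n] unfolding I_def by (metis finite.emptyI)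
    then show ?thesis using T(1) unfolding bintree_def by blast
  qed
  moreover have "q n \<in> {0, 1}" for n using PS[of n] by (rule conjunct2)
  then have "range q \<subseteq> {0, 1}" by (rule image_subsetI)
  ultimately have "q \<in> paths T" by (simp add: paths_def)
  then show ?thesis by blast
qed

lemma mdom_WKL: "mdom WKL = {T. bintree T \<and> infinite T}"
  using konig by (auto simp: mdom_def WKL_def carrier_rep_tree)

lemma problem_WKL: "problem WKL"
proof (rule problemI)
  have "q \<in> carrier rep_cantor" if "q \<in> paths T" for q T
    using that by (auto simp: paths_def ran_def rep_cantor_def intro!: exI[of _ q])
  then show "\<And>T. val WKL T \<noteq> {} \<Longrightarrow>
      T \<in> carrier (src WKL) \<and> val WKL T \<subseteq> carrier (tgt WKL)"
    by (auto simp: WKL_def carrier_rep_tree split: if_splits)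
qed

end

theory Submission
  imports Defs
begin

text \<open>
  Only continuity of the two reduction functions matters. A condition fixes a finite part of the
  input and declares the first \<open>N\<close> sequences constant from there on, with values \<open>c i\<close>; it is good
  if every input meeting it has a path on which each of the first \<open>N\<close> answers is undefined or
  equal to \<open>c i\<close>, hence wrong. A good condition extends to a good one for \<open>N + 1\<close>: otherwise every
  choice of the next limit is refuted, and by compactness at a finite stage. The first refutation
  confines the next answer to a finite set of values; choosing these values in turn as the limit
  and refuting each of them leaves no path at all. In the limit one gets an input whose
  sequences all converge and, again by compactness, a path on which every answer is wrong.
\<close>

section \<open>Continuity of computable functions\<close>

definition agree :: "nat \<Rightarrow> baire \<Rightarrow> baire \<Rightarrow> bool" where
  "agree m p q \<longleftrightarrow> (\<forall>j<m. p j = q j)"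

lemma agree_refl [simp]: "agree m p p"
  by (simp add: agree_def)

lemma agree_mono: "agree m p q \<Longrightarrow> k \<le> m \<Longrightarrow> agree k p q"
  by (auto simp: agree_def)

lemma agree_trans: "agree m p q \<Longrightarrow> agree m q r \<Longrightarrow> agree m p r"
  by (auto simp: agree_def)

lemma agree_pair: "agree m p p' \<Longrightarrow> agree m q q' \<Longrightarrow> agree m (pair p q) (pair p' q')"
  by (auto simp: agree_def pair_def)

inductive_cases eval_ZeroE: "eval p Zero xs y"
inductive_cases eval_SuccE: "eval p Succ xs y"
inductive_cases eval_ProjE: "eval p (Proj i) xs y"
inductive_cases eval_OracleE: "eval p Oracle xs y"
inductive_cases eval_CompE: "eval p (Comp f gs) xs y"
inductive_cases eval_PrimRec_0E: "eval p (PrimRec f g) (0 # xs) y"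
inductive_cases eval_PrimRec_SucE: "eval p (PrimRec f g) (Suc n # xs) y"
inductive_cases eval_MuE: "eval p (Mu f) xs y"

lemma eval_unique: "eval p e xs y \<Longrightarrow> eval p e xs z \<Longrightarrow> y = z"
proof (induction arbitrary: z rule: eval.induct)
  case Zero
  then show ?case by (rule eval_ZeroE) simp
next
  case Succ
  then show ?case by (rule eval_SuccE) simp
next
  case Proj
  from Proj.prems show ?case by (rule eval_ProjE) simp
next
  case Oracle
  then show ?case by (rule eval_OracleE) simp
next
  case PrimRec_0
  from PrimRec_0.prems show ?case by (rule eval_PrimRec_0E) (rule PrimRec_0.IH)
next
  case (Comp xs gs ys f y)
  from Comp.prems obtain ys' where ys': "list_all2 (\<lambda>g y. eval p g xs y) gs ys'" "eval p f ys' z"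
    by (rule eval_CompE)
  have "ys = ys'"
    using Comp.IH(1) ys'(1) by (auto simp: list_all2_conv_all_nth intro!: nth_equalityI)
  then show ?case using Comp.IH(2) ys'(2) by blast
next
  case (PrimRec_Suc f g n xs y z')
  from PrimRec_Suc.prems show ?case
    by (rule eval_PrimRec_SucE) (use PrimRec_Suc.IH in blast)
next
  case (Mu f n xs)
  from Mu.prems have z: "eval p f (z # xs) 0" "\<forall>m<z. \<exists>y. eval p f (m # xs) (Suc y)"
    by (auto elim: eval_MuE)
  have "\<not> z < n" using Mu.IH(2) z(1) by fastforce
  moreover have "\<not> n < z" using Mu.IH(1) z(2) by fastforce
  ultimately show ?case by simp
qed

text \<open>Finitely many moduli have a common upper bound, for which their sum is taken, so
  \<open>n = 0\<close> needs no separate case.\<close>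

lemma finite_use:
  fixes Q :: "nat \<Rightarrow> baire \<Rightarrow> bool"
  assumes "\<And>i. i < n \<Longrightarrow> \<exists>m. \<forall>p'. agree m p p' \<longrightarrow> Q i p'"
  shows "\<exists>m. \<forall>p'. agree m p p' \<longrightarrow> (\<forall>i<n. Q i p')"
proof -
  obtain f where f: "\<And>i p'. i < n \<Longrightarrow> agree (f i) p p' \<Longrightarrow> Q i p'"
    using assms by metis
  have "f i \<le> (\<Sum>i<n. f i)" if "i < n" for i
    using that by (intro member_le_sum) auto
  then show ?thesis using f agree_mono by blast
qed

text \<open>A terminating computation queries the oracle finitely often. In the cases of composition
  and minimization finitely many subcomputations occur, and \<open>finite_use\<close> merges their
  moduli.\<close>

lemma eval_continuous: "eval p e xs y \<Longrightarrow> \<exists>m. \<forall>p'. agree m p p' \<longrightarrow> eval p' e xs y"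
proof (induction rule: eval.induct)
  case (Oracle x)
  have "eval p' Defs.Oracle [x] (p x)" if "agree (Suc x) p p'" for p'
    using that eval.Oracle[of p' x] by (simp add: agree_def)
  then show ?case by blast
next
  case (Comp xs gs ys f z)
  have len: "length gs = length ys"
    using Comp.IH(1) by (rule list_all2_lengthD)
  have "\<exists>m. \<forall>p'. agree m p p' \<longrightarrow> (\<forall>i<length ys. eval p' (gs ! i) xs (ys ! i))"
    using Comp.IH(1) by (intro finite_use) (auto simp: list_all2_conv_all_nth)
  then obtain m where m: "\<And>p'. agree m p p' \<Longrightarrow> list_all2 (\<lambda>g y. eval p' g xs y) gs ys"
    using len by (auto simp: list_all2_conv_all_nth)
  from Comp.IH(2) obtain k where k: "\<And>p'. agree k p p' \<Longrightarrow> eval p' f ys z" by blast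
  have "eval p' (recf.Comp f gs) xs z" if "agree (max m k) p p'" for p'
    using that by (intro eval.Comp[OF m k]) (auto elim: agree_mono)
  then show ?case by blast
next
  case (PrimRec_Suc f g n xs y z)
  then obtain m k where
    m: "\<And>p'. agree m p p' \<Longrightarrow> eval p' (PrimRec f g) (n # xs) y" and
    k: "\<And>p'. agree k p p' \<Longrightarrow> eval p' g (n # y # xs) z" by blast
  have "eval p' (PrimRec f g) (Suc n # xs) z" if "agree (max m k) p p'" for p'
    using that by (intro eval.PrimRec_Suc[OF m k]) (auto elim: agree_mono)
  then show ?case by blast
next
  case (Mu f n xs)
  have "\<exists>m. \<forall>p'. agree m p p' \<longrightarrow> (\<forall>i<n. \<exists>y. eval p' f (i # xs) (Suc y))"
    using Mu.IH(2) by (intro finite_use) blast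
  then obtain m where m: "\<And>p'. agree m p p' \<Longrightarrow> \<forall>i<n. \<exists>y. eval p' f (i # xs) (Suc y)" by blast
  from Mu.IH(1) obtain k where k: "\<And>p'. agree k p p' \<Longrightarrow> eval p' f (n # xs) 0" by blast
  have "eval p' (recf.Mu f) xs n" if "agree (max m k) p p'" for p'
    using that by (intro eval.Mu[OF k m]) (auto elim: agree_mono)
  then show ?case by blast
qed (blast intro: eval.intros)+

text \<open>On an oracle near \<open>p\<close> the program still outputs the first \<open>k\<close>
  values of \<open>r\<close>; if \<open>F\<close> is defined there, uniqueness of evaluation
  identifies them with those of \<open>r'\<close>. Outside the domain of \<open>F\<close> the
  program is unconstrained, hence the premise on \<open>F p'\<close>.\<close>

lemma computable_continuous:
  assumes "computable F" "F p = Some r"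
  shows "\<exists>m. \<forall>p' r'. agree m p p' \<longrightarrow> F p' = Some r' \<longrightarrow> agree k r r'"
proof -
  from assms(1) obtain e where e: "\<And>p r n. F p = Some r \<Longrightarrow> eval p e [n] (r n)"
    unfolding computable_def by blast
  have "\<exists>m. \<forall>p'. agree m p p' \<longrightarrow> (\<forall>j<k. eval p' e [j] (r j))"
    using assms(2) by (intro finite_use eval_continuous e)
  then obtain m where m: "\<And>p' j. agree m p p' \<Longrightarrow> j < k \<Longrightarrow> eval p' e [j] (r j)" by blast
  have "agree k r r'" if "agree m p p'" "F p' = Some r'" for p' r'
    unfolding agree_def using eval_unique[OF m[OF that(1)] e[OF that(2)]] by blast
  then show ?thesis by blast
qed

section \<open>Forcing wrong answers on a compact set of paths\<close>

text \<open>Compactness of Cantor space, obtained from \<open>konig\<close>: the words that are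
  prefixes of infinitely many \<open>Q n\<close> form an infinite tree, and any path of it is a
  cluster point.\<close>

lemma cantor_cluster_point:
  assumes "\<And>n. range (Q n) \<subseteq> {0, 1 :: nat}"
  shows "\<exists>q. \<forall>k. \<exists>n\<ge>k. agree k q (Q n)"
proof -
  define T where "T = {w. infinite {n. map (Q n) [0..<length w] = w}}"
  have "T \<subseteq> words"
  proof
    fix w assume "w \<in> T"
    then have "{n. map (Q n) [0..<length w] = w} \<noteq> {}"
      unfolding T_def mem_Collect_eq by (rule infinite_imp_nonempty)
    then obtain n where n: "map (Q n) [0..<length w] = w" by blast
    have "set (map (Q n) [0..<length w]) \<subseteq> range (Q n)" by auto
    then have "set w \<subseteq> {0, 1}" unfolding n using assms[of n] by (rule order_trans)
    then show "w \<in> words" by (simp add: words_def)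
  qed
  moreover have "v \<in> T" if "v @ w \<in> T" for v w
  proof -
    have "{n. map (Q n) [0..<length (v @ w)] = v @ w} \<subseteq> {n. map (Q n) [0..<length v] = v}"
    proof
      fix n assume "n \<in> {n. map (Q n) [0..<length (v @ w)] = v @ w}"
      then have "take (length v) (map (Q n) [0..<length (v @ w)]) = v" by simp
      then show "n \<in> {n. map (Q n) [0..<length v] = v}" by (simp add: take_map)
    qed
    then show ?thesis using that unfolding T_def mem_Collect_eq by (rule infinite_super)
  qed
  ultimately have "bintree T" by (auto simp: bintree_def)
  moreover have "infinite T"
  proof -
    have "k \<in> length ` T" for k
    proof -
      define W where "W = {w. set w \<subseteq> {0, 1 :: nat} \<and> length w = k}"
      have "finite W" unfolding W_def by (rule finite_lists_length_eq) simp
      moreover have "map (Q n) [0..<k] \<in> W" for n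
      proof -
        have "Q n j \<in> {0, 1}" for j using assms[of n] by blast
        then show ?thesis by (simp add: W_def image_subset_iff)
      qed
      \<comment> \<open>Infinitely many prefixes of length \<open>k\<close> fall into finitely many
        words, so each length contributes a word to \<open>T\<close>.\<close>
      ultimately have "\<exists>w\<in>W. infinite {n \<in> UNIV. map (Q n) [0..<k] = w}"
        by (intro pigeonhole_infinite_rel) auto
      then have "\<exists>w\<in>T. length w = k" by (auto simp: T_def W_def)
      then show ?thesis by blast
    qed
    then have "length ` T = UNIV" by blast
    then show ?thesis by (metis finite_imageI infinite_UNIV_nat)
  qed
  ultimately have "paths T \<noteq> {}" by (rule konig)
  then obtain q where q: "\<And>k. map q [0..<k] \<in> T" by (auto simp: paths_def)
  have "\<exists>n\<ge>k. agree k q (Q n)" for k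
  proof -
    have "infinite {n. map (Q n) [0..<k] = map q [0..<k]}" using q[of k] by (simp add: T_def)
    then obtain n where "n \<ge> k" "map (Q n) [0..<k] = map q [0..<k]"
      by (auto simp: infinite_nat_iff_unbounded_le)
    then show ?thesis by (auto simp: agree_def)
  qed
  then show ?thesis by blast
qed

section \<open>Inputs with convergent rows and an abstract form of the reduction\<close>

definition row :: "baire \<Rightarrow> nat \<Rightarrow> baire" where
  "row p i k = p (cantor_pair i k)"

text \<open>These are the names of the instances of \<open>stash NLIM\<close>.\<close>

definition conv_rows :: "baire set" where
  "conv_rows = {p. \<forall>i. convergent (row p i)}"

text \<open>Used to turn a constraint on all codes from some \<open>n\<close> on into one on a tail
  of each row.\<close>

lemma le_cantor_pair: "k \<le> cantor_pair i k"
  by (simp add: cantor_pair_def)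

text \<open>\<open>P p\<close> plays the role of the paths of the tree computed from \<open>p\<close>, and \<open>Y p q i\<close> is the
  \<open>i\<close>-th answer read off from the path \<open>q\<close>, with \<open>None\<close> for an undefined answer.\<close>

locale answers =
  fixes P :: "baire \<Rightarrow> baire set" and Y :: "baire \<Rightarrow> baire \<Rightarrow> nat \<Rightarrow> nat option"
  assumes nonempty: "p \<in> conv_rows \<Longrightarrow> P p \<noteq> {}"
    and binary: "p \<in> conv_rows \<Longrightarrow> q \<in> P p \<Longrightarrow> range q \<subseteq> {0, 1}"
    and closed: "p \<in> conv_rows \<Longrightarrow>
      (\<And>m. \<exists>p'\<in>conv_rows. \<exists>q'\<in>P p'. agree m p p' \<and> agree m q q') \<Longrightarrow> q \<in> P p"
    and persistent: "p \<in> conv_rows \<Longrightarrow> q \<in> P p \<Longrightarrow> Y p q i = Some v \<Longrightarrow>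
      \<exists>m. \<forall>p'\<in>conv_rows. \<forall>q'\<in>P p'. agree m p p' \<longrightarrow> agree m q q' \<longrightarrow> Y p' q' i = Some v"
begin

text \<open>If every stage \<open>m\<close> had a counterexample, the paths involved would cluster
  at some \<open>q\<close>. By \<open>closed\<close> this \<open>q\<close> lies in
  \<open>P p\<close>, and the local hypothesis at \<open>q\<close> together with monotonicity
  excludes late counterexamples.\<close>

lemma compactness:
  assumes p: "p \<in> conv_rows"
    and mono: "\<And>m n p q. m \<le> n \<Longrightarrow> R m p q \<Longrightarrow> R n p q"
    and locally: "\<And>q. q \<in> P p \<Longrightarrow>
      \<exists>m. \<forall>p'\<in>conv_rows. \<forall>q'\<in>P p'. agree m p p' \<longrightarrow> agree m q q' \<longrightarrow> R m p' q'"
  shows "\<exists>m. \<forall>p'\<in>conv_rows. \<forall>q'\<in>P p'. agree m p p' \<longrightarrow> R m p' q'"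
proof (rule ccontr)
  assume "\<not> ?thesis"
  then have "\<forall>m. \<exists>p' q'. p' \<in> conv_rows \<and> q' \<in> P p' \<and> agree m p p' \<and> \<not> R m p' q'" by blast
  then obtain p' q' where pq: "\<And>m. p' m \<in> conv_rows" "\<And>m. q' m \<in> P (p' m)"
    "\<And>m. agree m p (p' m)" "\<And>m. \<not> R m (p' m) (q' m)" by metis
  obtain q where q: "\<And>k. \<exists>n\<ge>k. agree k q (q' n)"
    using cantor_cluster_point[of q', OF binary[OF pq(1,2)]] by blast
  have "q \<in> P p"
    using p
  proof (rule closed)
    fix m
    obtain n where "n \<ge> m" "agree m q (q' n)" using q by blast
    then show "\<exists>p'\<in>conv_rows. \<exists>q'\<in>P p'. agree m p p' \<and> agree m q q'"
      using pq(1,2) agree_mono[OF pq(3)] by blast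
  qed
  then obtain m where m: "\<And>p' q'. p' \<in> conv_rows \<Longrightarrow> q' \<in> P p' \<Longrightarrow> agree m p p' \<Longrightarrow>
      agree m q q' \<Longrightarrow> R m p' q'" using locally by blast
  obtain n where "n \<ge> m" "agree m q (q' n)" using q by blast
  then have "R m (p' n) (q' n)" using m pq(1,2) agree_mono[OF pq(3)] by blast
  then show False using mono \<open>n \<ge> m\<close> pq(4) by blast
qed

section \<open>Conditions and their extension by one more limit\<close>

definition wrong :: "baire \<Rightarrow> baire \<Rightarrow> baire \<Rightarrow> nat \<Rightarrow> bool" where
  "wrong c p q i \<longleftrightarrow> Y p q i \<in> {None, Some (c i)}"

text \<open>An answer that is not wrong is defined, so a finite part of input and path decides it.
  The value \<open>u\<close> is the same for all neighbours, which later bounds the answers.\<close>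

lemma not_wrong_persistent:
  assumes "p \<in> conv_rows" "q \<in> P p" "\<not> wrong c p q i"
  shows "\<exists>m u. \<forall>p'\<in>conv_rows. \<forall>q'\<in>P p'. agree m p p' \<longrightarrow> agree m q q' \<longrightarrow>
    u \<noteq> c i \<and> Y p' q' i = Some u"
proof -
  obtain u where "u \<noteq> c i" "Y p q i = Some u" using assms(3) by (auto simp: wrong_def)
  then show ?thesis using persistent[OF assms(1,2)] by metis
qed

text \<open>The stage \<open>n\<close> counts positions of the interleaved name, not of a single
  row. Rows from \<open>N\<close> on are free beyond the prefix, as long as they converge.\<close>

definition cond :: "baire \<Rightarrow> nat \<Rightarrow> baire \<Rightarrow> nat \<Rightarrow> baire set" where
  "cond p n c N = {p' \<in> conv_rows. agree n p p' \<and>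
     (\<forall>i<N. \<forall>k. n \<le> cantor_pair i k \<longrightarrow> p' (cantor_pair i k) = c i)}"

text \<open>A position before \<open>n'\<close> is inherited from \<open>p'\<close>, which already
  obeys the first condition; from \<open>n'\<close> on the second one prescribes the same
  values.\<close>

lemma cond_trans:
  assumes "p' \<in> cond p n c N" "p'' \<in> cond p' n' c' N'" "n \<le> n'" "N \<le> N'" "\<And>i. i < N \<Longrightarrow> c' i = c i"
  shows "p'' \<in> cond p n c N"
proof -
  have "p'' (cantor_pair i k) = c i" if "i < N" "n \<le> cantor_pair i k" for i k
  proof (cases "cantor_pair i k < n'")
    case True
    then have "p'' (cantor_pair i k) = p' (cantor_pair i k)"
      using assms(2) by (auto simp: cond_def agree_def)
    then show ?thesis using assms(1) that by (auto simp: cond_def)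
  next
    case False
    then show ?thesis using assms(2,4,5) that by (auto simp: cond_def)
  qed
  moreover have "agree n p p''"
    using assms(1-3) by (auto simp: cond_def agree_def)
  ultimately show ?thesis using assms(2) by (auto simp: cond_def)
qed

lemma cond_self: "p' \<in> cond p n c N \<Longrightarrow> n \<le> n' \<Longrightarrow> p' \<in> cond p' n' c N"
  by (auto simp: cond_def)

definition good :: "baire \<Rightarrow> nat \<Rightarrow> baire \<Rightarrow> nat \<Rightarrow> bool" where
  "good p n c N \<longleftrightarrow> (\<forall>p'\<in>cond p n c N. \<exists>q\<in>P p'. \<forall>i<N. wrong c p' q i)"

text \<open>An index \<open>i < N\<close> of an answer that is not wrong is excluded by the premise
  on the first \<open>N\<close> answers, so only \<open>N\<close> remains. One number
  \<open>m\<close> serves as stage and as bound on the answer; thus compactness confines the answers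
  to a finite set.\<close>

lemma refutation:
  assumes p: "p \<in> conv_rows"
    and "\<And>q. q \<in> P p \<Longrightarrow> \<exists>i<Suc N. \<not> wrong (c(N := v)) p q i"
  shows "\<exists>m. \<forall>p'\<in>conv_rows. \<forall>q'\<in>P p'. agree m p p' \<longrightarrow> (\<forall>i<N. wrong c p' q' i) \<longrightarrow>
    (\<exists>u\<le>m. u \<noteq> v \<and> Y p' q' N = Some u)"
proof -
  let ?R = "\<lambda>m p' q'. (\<forall>i<N. wrong c p' q' i) \<longrightarrow> (\<exists>u\<le>m. u \<noteq> v \<and> Y p' q' N = Some u)"
  have "\<exists>m. \<forall>p'\<in>conv_rows. \<forall>q'\<in>P p'. agree m p p' \<longrightarrow> agree m q q' \<longrightarrow> ?R m p' q'"
    if q: "q \<in> P p" for q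
  proof -
    obtain i where i: "i < Suc N" "\<not> wrong (c(N := v)) p q i" using assms(2)[OF q] by blast
    then obtain m u where m: "\<And>p' q'. p' \<in> conv_rows \<Longrightarrow> q' \<in> P p' \<Longrightarrow> agree m p p' \<Longrightarrow>
        agree m q q' \<Longrightarrow> u \<noteq> (c(N := v)) i \<and> Y p' q' i = Some u"
      using not_wrong_persistent[OF p q] by meson
    have "?R (max m u) p' q'"
      if "p' \<in> conv_rows" "q' \<in> P p'" "agree (max m u) p p'" "agree (max m u) q q'" for p' q'
    proof -
      have *: "u \<noteq> (c(N := v)) i" "Y p' q' i = Some u"
        using m that agree_mono by (meson max.cobounded1)+
      show ?thesis
      proof (cases "i = N")
        case True
        then show ?thesis using * by (auto intro!: exI[of _ u])
      next
        case False
        then have "\<not> wrong c p' q' i" using * by (simp add: wrong_def)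
        then show ?thesis using i(1) False by auto
      qed
    qed
    then show ?thesis by blast
  qed
  moreover have "?R n p' q'" if "m \<le> n" "?R m p' q'" for m n p' q'
    using that le_trans by blast
  ultimately show ?thesis using compactness[OF p, of ?R] by blast
qed

text \<open>The strict \<open>n < n'\<close> makes the stages of an iteration unbounded, and
  \<open>p'\<close> meeting its own condition allows the next extension.\<close>

lemma good_extend:
  assumes "p \<in> cond p n c N" "good p n c N"
  shows "\<exists>p' n' v. p' \<in> cond p n c N \<and> n < n' \<and> p' \<in> cond p' n' (c(N := v)) (Suc N) \<and>
    good p' n' (c(N := v)) (Suc N)"
proof (rule ccontr)
  assume contra: "\<not> ?thesis"
  \<comment> \<open>Below any refinement and for every \<open>v\<close>, some input has only paths
    that refute \<open>v\<close> as next limit.\<close>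
  have defeat: "\<exists>p1\<in>cond p' n' c N. \<forall>q\<in>P p1. \<exists>i<Suc N. \<not> wrong (c(N := v)) p1 q i"
    if p': "p' \<in> cond p n c N" "n \<le> n'" for p' n' v
  proof -
    \<comment> \<open>Row \<open>N\<close> is set to \<open>v\<close> from code \<open>n'\<close>
      on. The second component of \<open>prod_decode j\<close> is the row index.\<close>
    define p2 where "p2 j = (if n' \<le> j \<and> snd (prod_decode j) = N then v else p' j)" for j
    have p2: "p2 (cantor_pair i k) = (if n' \<le> cantor_pair i k \<and> i = N then v else p' (cantor_pair i k))"
      for i k unfolding p2_def cantor_pair_eq_prod_encode by simp
    have "convergent (row p2 i)" for i
    proof (cases "i = N")
      case True
      then have "eventually (\<lambda>k. row p2 i k = v) sequentially"
        unfolding eventually_sequentially row_def p2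
        by (intro exI[of _ n']) (use le_cantor_pair le_trans in fastforce)
      then show ?thesis using tendsto_eventually convergentI by blast
    next
      case False
      then have "row p2 i = row p' i" by (auto simp: row_def p2)
      then show ?thesis using p'(1) by (simp add: cond_def conv_rows_def)
    qed
    then have "p2 \<in> conv_rows" by (simp add: conv_rows_def)
    moreover have agr: "agree n' p' p2" by (simp add: agree_def p2_def)
    ultimately have p2_cond: "p2 \<in> cond p n c N" "p2 \<in> cond p2 n' (c(N := v)) (Suc N)"
      "p2 \<in> cond p' n' c N"
      using p' by (auto simp: cond_def p2 intro: agree_trans agree_mono)
    \<comment> \<open>Only \<open>n \<le> n'\<close> is known, while \<open>contra\<close> speaks of
      stages strictly above \<open>n\<close>.\<close>
    then have "p2 \<in> cond p2 (Suc n') (c(N := v)) (Suc N)" "n < Suc n'"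
      using cond_self p'(2) by simp_all
    then have "\<not> good p2 (Suc n') (c(N := v)) (Suc N)"
      using contra p2_cond(1) by blast
    then obtain p1 where p1: "p1 \<in> cond p2 (Suc n') (c(N := v)) (Suc N)"
      "\<forall>q\<in>P p1. \<exists>i<Suc N. \<not> wrong (c(N := v)) p1 q i"
      unfolding good_def by blast
    have "p1 \<in> cond p' n' c N"
      using cond_trans[OF p2_cond(3) p1(1)] by simp
    then show ?thesis using p1(2) by blast
  qed
  \<comment> \<open>Induction on the set \<open>V\<close> of values left for answer
    \<open>N\<close>: refuting the limit \<open>v\<close> removes \<open>v\<close> from it. For
    empty \<open>V\<close>, goodness still supplies a path with the first \<open>N\<close> answers
    wrong, and its answer \<open>N\<close> has no value left.\<close>
  have confined: False
    if "finite V" "p' \<in> cond p n c N" "n \<le> n'"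
      "\<And>p1 q. p1 \<in> cond p' n' c N \<Longrightarrow> q \<in> P p1 \<Longrightarrow> \<forall>i<N. wrong c p1 q i \<Longrightarrow> Y p1 q N \<in> Some ` V"
    for V p' n'
    using that
  proof (induction V arbitrary: p' n' rule: finite_induct)
    case empty
    have "p' \<in> cond p n c N" by fact
    then obtain q where "q \<in> P p'" "\<forall>i<N. wrong c p' q i"
      using assms(2) unfolding good_def by blast
    moreover have "p' \<in> cond p' n' c N" using empty cond_self by blast
    ultimately show ?case using empty.prems(3) by blast
  next
    case (insert v V)
    obtain p1 where p1: "p1 \<in> cond p' n' c N"
      "\<And>q. q \<in> P p1 \<Longrightarrow> \<exists>i<Suc N. \<not> wrong (c(N := v)) p1 q i"
      using defeat[OF insert.prems(1,2)] by metis
    then have "p1 \<in> conv_rows" by (simp add: cond_def)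
    from refutation[OF this p1(2)] obtain m where
      m: "\<And>p2 q. p2 \<in> conv_rows \<Longrightarrow> q \<in> P p2 \<Longrightarrow> agree m p1 p2 \<Longrightarrow> \<forall>i<N. wrong c p2 q i \<Longrightarrow>
        \<exists>u\<le>m. u \<noteq> v \<and> Y p2 q N = Some u" by metis
    show ?case
    proof (rule insert.IH[of p1 "max n' m"])
      show "p1 \<in> cond p n c N" using cond_trans insert.prems(1,2) p1(1) by blast
      show "n \<le> max n' m" using insert.prems(2) by simp
      fix p2 q assume *: "p2 \<in> cond p1 (max n' m) c N" "q \<in> P p2" "\<forall>i<N. wrong c p2 q i"
      have "p2 \<in> conv_rows" "agree m p1 p2"
        using *(1) by (auto simp: cond_def intro: agree_mono)
      then have "\<exists>u. u \<noteq> v \<and> Y p2 q N = Some u" using m * by blast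
      moreover have "p2 \<in> cond p' n' c N" using cond_trans[OF p1(1) *(1)] by simp
      then have "Y p2 q N \<in> Some ` insert v V" using insert.prems(3) * by blast
      ultimately show "Y p2 q N \<in> Some ` V" by auto
    qed
  qed
  \<comment> \<open>The limit 0 is an arbitrary first choice; its refutation yields the bound
    \<open>m\<close> and thus the finite set for \<open>confined\<close>.\<close>
  obtain p1 where p1: "p1 \<in> cond p n c N"
    "\<And>q. q \<in> P p1 \<Longrightarrow> \<exists>i<Suc N. \<not> wrong (c(N := 0)) p1 q i"
    using defeat[OF assms(1) order_refl] by metis
  then have "p1 \<in> conv_rows" by (simp add: cond_def)
  from refutation[OF this p1(2)] obtain m where
    m: "\<And>p2 q. p2 \<in> conv_rows \<Longrightarrow> q \<in> P p2 \<Longrightarrow> agree m p1 p2 \<Longrightarrow> \<forall>i<N. wrong c p2 q i \<Longrightarrow>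
      \<exists>u\<le>m. u \<noteq> 0 \<and> Y p2 q N = Some u" by metis
  have "Y p2 q N \<in> Some ` {..m}"
    if "p2 \<in> cond p1 (max n m) c N" "q \<in> P p2" "\<forall>i<N. wrong c p2 q i" for p2 q
  proof -
    have "p2 \<in> conv_rows" "agree m p1 p2"
      using that(1) by (auto simp: cond_def intro: agree_mono)
    then show ?thesis using m that by fastforce
  qed
  then show False using confined[of "{..m}" p1 "max n m"] p1(1) by simp
qed

text \<open>Iterating \<open>good_extend\<close> gives a chain of conditions with a common input
  \<open>x\<close>. For each \<open>N\<close> some path of \<open>x\<close> has its first
  \<open>N\<close> answers wrong; compactness turns these into one path.\<close>

lemma all_wrong: "\<exists>p\<in>conv_rows. \<exists>q\<in>P p. \<forall>i. Y p q i \<in> {None, Some (lim (row p i))}"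
proof -
  define S where "S N = (\<lambda>(p, n, c). p \<in> cond p n c N \<and> good p n c N)" for N
  define Q where "Q N = (\<lambda>(p, n :: nat, c) (p', n', c').
    p' \<in> cond p n c N \<and> n < n' \<and> (\<forall>i<N. c' i = c i))" for N
  have "(\<lambda>_. 0) \<in> conv_rows" by (simp add: conv_rows_def row_def[abs_def] convergent_const)
  \<comment> \<open>For \<open>N = 0\<close> goodness only says that paths exist.\<close>
  then have "S 0 (\<lambda>_. 0, 0, \<lambda>_. 0)"
    using nonempty by (auto simp: S_def cond_def good_def)
  moreover have "\<exists>t. S (Suc N) t \<and> Q N s t" if s: "S N s" for N s
  proof -
    obtain p n c where "s = (p, n, c)" by (cases s)
    with s good_extend[of p n c N] obtain p' n' v where
      "p' \<in> cond p n c N" "n < n'" "p' \<in> cond p' n' (c(N := v)) (Suc N)"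
      "good p' n' (c(N := v)) (Suc N)" by (auto simp: S_def)
    then show ?thesis
      by (intro exI[of _ "(p', n', c(N := v))"]) (simp add: S_def Q_def \<open>s = _\<close>)
  qed
  ultimately obtain f where f: "\<And>N. S N (f N)" "\<And>N. Q N (f N) (f (Suc N))"
    using dependent_nat_choice[of S Q] by blast
  define p where "p N = fst (f N)" for N
  define n where "n N = fst (snd (f N))" for N
  define c where "c N = snd (snd (f N))" for N
  have f_eq: "f N = (p N, n N, c N)" for N by (simp add: p_def n_def c_def)
  have self: "p N \<in> cond (p N) (n N) (c N) N" and good: "good (p N) (n N) (c N) N" for N
    using f(1)[of N] by (simp_all add: S_def f_eq)
  have next_cond: "p (Suc N) \<in> cond (p N) (n N) (c N) N" and next_n: "n N < n (Suc N)"
    and next_c: "\<And>i. i < N \<Longrightarrow> c (Suc N) i = c N i" for N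
    using f(2)[of N] by (simp_all add: Q_def f_eq)
  have n_ge: "N \<le> n N" for N
  proof (induction N)
    case (Suc N)
    then show ?case using next_n[of N] by linarith
  qed simp
  have chain: "p M \<in> cond (p N) (n N) (c N) N" "n N \<le> n M" "\<And>i. i < N \<Longrightarrow> c M i = c N i"
    if "N \<le> M" for N M
  proof -
    have "p M \<in> cond (p N) (n N) (c N) N \<and> n N \<le> n M \<and> (\<forall>i<N. c M i = c N i)"
      using that
    proof (induction M rule: dec_induct)
      case base
      show ?case using self by simp
    next
      case (step M)
      then have IH: "p M \<in> cond (p N) (n N) (c N) N" "n N \<le> n M" "\<And>i. i < N \<Longrightarrow> c M i = c N i"
        and "N \<le> M" by blast+
      have "p (Suc M) \<in> cond (p N) (n N) (c N) N"
        using IH(1) next_cond IH(2) \<open>N \<le> M\<close> IH(3) by (rule cond_trans)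
      moreover have "n N \<le> n (Suc M)" using IH(2) next_n[of M] by linarith
      moreover have "c (Suc M) i = c N i" if "i < N" for i
        using IH(3) next_c[of i M] that \<open>N \<le> M\<close> by simp
      ultimately show ?case by blast
    qed
    then show "p M \<in> cond (p N) (n N) (c N) N" "n N \<le> n M" "\<And>i. i < N \<Longrightarrow> c M i = c N i" by blast+
  qed
  \<comment> \<open>Since \<open>Suc j \<le> n (Suc j)\<close>, entry \<open>j\<close> no longer
    changes from stage \<open>Suc j\<close> on. Likewise condition \<open>Suc i\<close> is the first
    to prescribe the limit of row \<open>i\<close>.\<close>
  define x where "x j = p (Suc j) j" for j
  define d where "d i = c (Suc i) i" for i
  have c_d: "c N i = d i" if "i < N" for N i
    using chain(3)[of "Suc i" N i] that by (simp add: d_def)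
  have x: "x j = p N j" if "j < n N" for j N
  proof (cases "Suc j \<le> N")
    case True
    then have "agree (n (Suc j)) (p (Suc j)) (p N)" using chain(1) by (simp add: cond_def)
    then show ?thesis using n_ge[of "Suc j"] by (simp add: x_def agree_def)
  next
    case False
    then have "agree (n N) (p N) (p (Suc j))" using chain(1)[of N "Suc j"] by (simp add: cond_def)
    then show ?thesis using that by (simp add: x_def agree_def)
  qed
  have locked: "x (cantor_pair i k) = d i" if "i < N" "n N \<le> cantor_pair i k" for i k N
  proof -
    let ?j = "cantor_pair i k"
    \<comment> \<open>Late enough that the position lies in the fixed prefix of \<open>p ?M\<close>
      and that \<open>p ?M\<close> meets condition \<open>N\<close>.\<close>
    let ?M = "max N (Suc ?j)"
    have "?j < n ?M" using n_ge[of ?M] by simp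
    then have "x ?j = p ?M ?j" by (rule x)
    also have "\<dots> = c N i" using chain(1)[of N ?M] that by (simp add: cond_def)
    finally show ?thesis using c_d that(1) by simp
  qed
  have lim: "row x i \<longlonglongrightarrow> d i" for i
  proof (rule tendsto_eventually)
    show "eventually (\<lambda>k. row x i k = d i) sequentially"
      unfolding eventually_sequentially row_def
      using locked[of i "Suc i"] le_cantor_pair le_trans by blast
  qed
  then have x_conv: "x \<in> conv_rows" by (auto simp: conv_rows_def convergent_def)
  \<comment> \<open>The limit meets every condition of the chain, so goodness applies to
    \<open>x\<close> itself.\<close>
  have "x \<in> cond (p N) (n N) (c N) N" for N
    using x_conv x locked c_d by (auto simp: cond_def agree_def)
  then have approx: "\<exists>q\<in>P x. \<forall>i<N. wrong d x q i" for N
    using good[of N] c_d unfolding good_def wrong_def by fastforce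
  have "\<exists>q\<in>P x. \<forall>i. wrong d x q i"
  proof (rule ccontr)
    assume "\<not> ?thesis"
    then have not_wrong: "\<exists>i. \<not> wrong d x q i" if "q \<in> P x" for q using that by blast
    \<comment> \<open>Bounding the index by the stage makes the property monotone; the uniform
      \<open>m\<close> from compactness then contradicts \<open>approx\<close> at
      \<open>m\<close>.\<close>
    have "\<exists>m. \<forall>p'\<in>conv_rows. \<forall>q'\<in>P p'. agree m x p' \<longrightarrow> agree m q q' \<longrightarrow>
        (\<exists>i<m. \<not> wrong d p' q' i)" if q: "q \<in> P x" for q
    proof -
      obtain i where "\<not> wrong d x q i" using not_wrong q by blast
      then obtain m u where m: "\<And>p' q'. p' \<in> conv_rows \<Longrightarrow> q' \<in> P p' \<Longrightarrow> agree m x p' \<Longrightarrow>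
          agree m q q' \<Longrightarrow> u \<noteq> d i \<and> Y p' q' i = Some u"
        using not_wrong_persistent[OF x_conv q] by meson
      have "\<not> wrong d p' q' i"
        if "p' \<in> conv_rows" "q' \<in> P p'" "agree (max m (Suc i)) x p'" "agree (max m (Suc i)) q q'"
        for p' q'
      proof -
        have "agree m x p'" "agree m q q'" using that(3,4) by (auto elim: agree_mono)
        then show ?thesis using m that(1,2) by (simp add: wrong_def)
      qed
      then show ?thesis by (intro exI[of _ "max m (Suc i)"]) (meson less_Suc_eq less_max_iff_disj)
    qed
    moreover have "\<exists>i<k. \<not> wrong d p q i" if "m \<le> k" "\<exists>i<m. \<not> wrong d p q i" for m k p q
      using that less_le_trans by blast
    ultimately have "\<exists>m. \<forall>p'\<in>conv_rows. \<forall>q'\<in>P p'. agree m x p' \<longrightarrow> (\<exists>i<m. \<not> wrong d p' q' i)"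
      by (rule compactness[OF x_conv, rotated])
    then obtain m where "\<And>q. q \<in> P x \<Longrightarrow> \<exists>i<m. \<not> wrong d x q i"
      using x_conv agree_refl by blast
    then show False using approx by blast
  qed
  moreover have "d i = lim (row x i)" for i using lim limI by metis
  ultimately show ?thesis using x_conv by (auto simp: wrong_def)
qed

end

section \<open>The reduction\<close>

text \<open>The first letter of \<open>p - 1\<close>. In contrast to the point of the completion named by \<open>p\<close>, it is
  also defined if \<open>p - 1\<close> is a nonempty finite word; this makes it depend continuously on \<open>p\<close>.\<close>

definition first_letter :: "baire \<Rightarrow> nat option" where
  "first_letter p = (if \<exists>k. p k \<noteq> 0 then Some (p (LEAST k. p k \<noteq> 0) - 1) else None)"

text \<open>The first nonzero entry of the row and the zeros before it occupy a finite part of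
  \<open>r\<close>.\<close>

lemma first_letter_persistent:
  assumes "first_letter (row r i) = Some v"
  shows "\<exists>m. \<forall>r'. agree m r r' \<longrightarrow> first_letter (row r' i) = Some v"
proof -
  let ?k = "LEAST k. row r i k \<noteq> 0"
  have "\<exists>k. row r i k \<noteq> 0" using assms by (auto simp: first_letter_def split: if_splits)
  then have k: "row r i ?k \<noteq> 0" "\<And>l. l < ?k \<Longrightarrow> row r i l = 0"
    by (auto intro: LeastI_ex dest: not_less_Least)
  have "\<exists>m. \<forall>r'. agree m r r' \<longrightarrow> (\<forall>l<Suc ?k. row r' i l = row r i l)"
    by (intro finite_use) (metis agree_def lessI row_def)
  then obtain m where m: "\<And>r' l. agree m r r' \<Longrightarrow> l \<le> ?k \<Longrightarrow> row r' i l = row r i l"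
    by (auto simp: less_Suc_eq_le)
  have "first_letter (row r' i) = Some v" if "agree m r r'" for r'
  proof -
    have k': "row r' i ?k \<noteq> 0" using m[OF that order_refl] k(1) by simp
    have "row r' i l = 0" if "l < ?k" for l
      using m[OF \<open>agree m r r'\<close> less_imp_le[OF that]] k(2)[OF that] by simp
    then have least: "(LEAST k. row r' i k \<noteq> 0) = ?k"
      using k' by (intro Least_equality) (assumption, metis not_less)
    have "first_letter (row r' i) = Some (row r' i (LEAST k. row r' i k \<noteq> 0) - 1)"
      using k' unfolding first_letter_def by metis
    also have "\<dots> = Some (row r i ?k - 1)"
      unfolding least m[OF that order_refl] ..
    also have "\<dots> = first_letter (row r i)"
      using k(1) unfolding first_letter_def by metis
    finally show ?thesis using assms by simp
  qed
  then show ?thesis by blast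
qed

text \<open>A natural number is named by its first entry, so only the first letter of
  \<open>p - 1\<close> counts.\<close>

lemma completion_first_letter:
  assumes "rep_completion rep_nat p = Some (Some z)"
  shows "first_letter p = Some z"
proof -
  have "infinite {i. p i \<noteq> 0}" and z: "z = p (enumerate {i. p i \<noteq> 0} 0) - 1"
    using assms by (auto simp: rep_completion_def minus_one_def rep_nat_def split: if_splits)
  then have "\<exists>k. p k \<noteq> 0" using not_finite_existsD by fastforce
  then show ?thesis using z by (simp add: first_letter_def enumerate_0)
qed

lemma stash_NLIM_outputD:
  assumes "rep_seq (rep_completion rep_nat) r = Some y" "y \<in> val (stash NLIM) (row p)"
  shows "\<exists>i. first_letter (row r i) \<notin> {None, Some (lim (row p i))}"
proof -
  obtain i z where z: "y i = Some z" "z \<in> val NLIM (row p i)"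
    using assms(2) by (auto simp: stash_def split: if_splits)
  have "rep_completion rep_nat (row r i) = Some (y i)"
    using assms(1) by (auto simp: rep_seq_def row_def[abs_def] rep_completion_def split: if_splits)
  then have "first_letter (row r i) = Some z"
    using z(1) completion_first_letter by simp
  moreover have "z \<noteq> lim (row p i)" using z(2) by (auto simp: NLIM_def split: if_splits)
  ultimately show ?thesis by (intro exI[of _ i]) simp
qed

lemma stash_NLIM_input:
  assumes "p \<in> conv_rows"
  shows "src (stash NLIM) p = Some (row p)" "row p \<in> mdom (stash NLIM)"
proof -
  show "src (stash NLIM) p = Some (row p)"
    by (simp add: stash_def rep_seq_def NLIM_def rep_baire_def row_def[abs_def] dom_def)
  show "row p \<in> mdom (stash NLIM)"
    using assms by (simp add: mdom_stash[OF problem_NLIM] mdom_NLIM conv_rows_def)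
qed

text \<open>A reduction must cope with every realizer, so any chosen solution can be forced as its
  value at \<open>t\<close>. Leaving \<open>G\<close> undefined off the names of instances lets
  definedness certify an instance.\<close>

lemma realizer_through:
  assumes "problem f" "src f t = Some x" "x \<in> mdom f" "tgt f q = Some y" "y \<in> val f x"
  obtains G where "realizer G f" "G t = Some q"
    "\<And>s. G s \<noteq> None \<Longrightarrow> \<exists>x\<in>mdom f. src f s = Some x"
proof -
  obtain F where F: "realizer F f" using assms(1) by (auto simp: problem_def)
  define G where
    "G = (\<lambda>s. if \<exists>x\<in>mdom f. src f s = Some x then F s else None)(t := Some q)"
  have "realizer G f"
    using F assms(2,4,5) unfolding realizer_def G_def by auto
  moreover have "G t = Some q" by (simp add: G_def)
  moreover have "\<exists>x\<in>mdom f. src f s = Some x" if "G s \<noteq> None" for s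
    using that assms(2,3) by (auto simp: G_def split: if_splits)
  ultimately show ?thesis by (rule that)
qed

lemma WKL_realizer_through:
  assumes "rep_tree t = Some T" "bintree T" "infinite T" "q \<in> paths T"
  obtains G where "realizer G WKL" "G t = Some q"
    "\<And>s. G s \<noteq> None \<Longrightarrow> \<exists>T. rep_tree s = Some T \<and> bintree T \<and> infinite T"
proof (rule realizer_through[OF problem_WKL])
  show "src WKL t = Some T" using assms(1) by (simp add: WKL_def)
  show "T \<in> mdom WKL" using assms(2,3) by (simp add: mdom_WKL)
  show "tgt WKL q = Some q" using assms(4) by (simp add: WKL_def rep_cantor_def paths_def)
  show "q \<in> val WKL T" using assms(2-4) by (simp add: WKL_def)
  fix G assume G: "realizer G WKL" "G t = Some q"
    "\<And>s. G s \<noteq> None \<Longrightarrow> \<exists>T\<in>mdom WKL. src WKL s = Some T"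
  have "\<exists>T. rep_tree s = Some T \<and> bintree T \<and> infinite T" if "G s \<noteq> None" for s
    using G(3)[OF that] by (auto simp: mdom_WKL) (auto simp: WKL_def)
  then show thesis using G(1,2) that by blast
qed

section \<open>The assumed reduction as an instance of \<open>answers\<close>\<close>

lemma mem_rep_tree_iff:
  assumes "rep_tree t = Some T"
  shows "w \<in> T \<longleftrightarrow> w \<in> words \<and> t (word_code w) = 1"
  using assms by (auto simp: rep_tree_def Let_def split: if_splits)

theorem proposition8p3: "\<not> stash NLIM \<le>\<^sub>W WKL"
proof
  assume "stash NLIM \<le>\<^sub>W WKL"
  then obtain H K where H: "computable H" and K: "computable K"
    and red: "\<And>G. realizer G WKL \<Longrightarrow>
      realizer (H \<circ>\<^sub>m (\<lambda>p. map_option (pair p) ((G \<circ>\<^sub>m K) p))) (stash NLIM)"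
    unfolding weihrauch_le_def by blast
  have answer: "\<exists>t q r y. K p = Some t \<and> G t = Some q \<and> H (pair p q) = Some r \<and>
      rep_seq (rep_completion rep_nat) r = Some y \<and> y \<in> val (stash NLIM) (row p)"
    if "realizer G WKL" "p \<in> conv_rows" for G p
  proof -
    have "\<exists>r y. (H \<circ>\<^sub>m (\<lambda>p. map_option (pair p) ((G \<circ>\<^sub>m K) p))) p = Some r \<and>
        tgt (stash NLIM) r = Some y \<and> y \<in> val (stash NLIM) (row p)"
      using red[OF that(1)] stash_NLIM_input[OF that(2)] unfolding realizer_def by blast
    moreover have "tgt (stash NLIM) = rep_seq (rep_completion rep_nat)"
      by (simp add: stash_def NLIM_def)
    ultimately show ?thesis
      by (auto simp: map_comp_def split: option.splits)
  qed
  have tree: "\<exists>t T. K p = Some t \<and> rep_tree t = Some T \<and> bintree T \<and> infinite T"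
    if "p \<in> conv_rows" for p
  proof -
    \<comment> \<open>The full tree supplies a realizer that is defined only on names of infinite
      trees. The reduction applies it to \<open>K p\<close>, which must therefore be such a
      name.\<close>
    have full: "bintree words" "infinite words"
      using bij_betw_word_code bij_betw_finite[OF bij_betw_word_code]
      by (auto simp: bintree_def words_def)
    obtain t where t: "rep_tree t = Some words"
      using full(1) carrier_rep_tree by (auto simp: ran_def)
    obtain q where q: "q \<in> paths words" using konig[OF full] by blast
    obtain G where G: "realizer G WKL"
      "\<And>s. G s \<noteq> None \<Longrightarrow> \<exists>T. rep_tree s = Some T \<and> bintree T \<and> infinite T"
      using WKL_realizer_through[OF t full q] by blast
    show ?thesis using answer[OF G(1) that] G(2) by fastforce
  qed
  define P where "P p = (case K p of None \<Rightarrow> {} | Some t \<Rightarrow> paths (the (rep_tree t)))" for p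
  define Y where "Y p q i = first_letter (row (the (H (pair p q))) i)" for p q i
  have P: "\<exists>t T. K p = Some t \<and> rep_tree t = Some T \<and> bintree T \<and> infinite T \<and> P p = paths T"
    if "p \<in> conv_rows" for p
    using tree[OF that] by (auto simp: P_def)
  \<comment> \<open>Every path \<open>q\<close> of the tree is the value of some realizer, so
    \<open>H\<close> has to accept it.\<close>
  have HP: "\<exists>r y. H (pair p q) = Some r \<and>
      rep_seq (rep_completion rep_nat) r = Some y \<and> y \<in> val (stash NLIM) (row p)"
    if p: "p \<in> conv_rows" and q: "q \<in> P p" for p q
  proof -
    obtain t T where T: "K p = Some t" "rep_tree t = Some T" "bintree T" "infinite T" "P p = paths T"
      using P[OF p] by blast
    obtain G where "realizer G WKL" "G t = Some q"
      using WKL_realizer_through[OF T(2-4)] q unfolding T(5) by blast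
    then show ?thesis using answer[OF _ p, of G] T(1) by auto
  qed
  interpret answers P Y
  proof
    fix p assume p: "p \<in> conv_rows"
    obtain t T where T: "K p = Some t" "rep_tree t = Some T" "bintree T" "infinite T" "P p = paths T"
      using P[OF p] by blast
    show "P p \<noteq> {}" using konig T(3-5) by simp
    show "range q \<subseteq> {0, 1}" if "q \<in> P p" for q using that T(5) by (simp add: paths_def)
    show "q \<in> P p" if lim: "\<And>m. \<exists>p'\<in>conv_rows. \<exists>q'\<in>P p'. agree m p p' \<and> agree m q q'" for q
    proof -
      have "range q \<subseteq> {0, 1}"
      proof (intro image_subsetI)
        fix n
        obtain p' q' where pq: "p' \<in> conv_rows" "q' \<in> P p'" "agree (Suc n) q q'"
          using lim by blast
        obtain T' where "P p' = paths T'" using P[OF pq(1)] by blast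
        then have "range q' \<subseteq> {0, 1}" using pq(2) by (simp add: paths_def)
        moreover have "q n = q' n" using pq(3) by (simp add: agree_def)
        ultimately show "q n \<in> {0, 1}" by auto
      qed
      moreover have "map q [0..<k] \<in> T" for k
      proof -
        let ?w = "map q [0..<k]"
        \<comment> \<open>Membership of \<open>?w\<close> in the tree is a single entry of its name,
          which by continuity of \<open>K\<close> depends on a finite part of \<open>p\<close>;
          hence it transfers from the tree of a nearby \<open>p'\<close>.\<close>
        obtain m where m: "\<And>p' t'. agree m p p' \<Longrightarrow> K p' = Some t' \<Longrightarrow>
            agree (Suc (word_code ?w)) t t'"
          using computable_continuous[OF K, OF T(1)] by blast
        obtain p' q' where p': "p' \<in> conv_rows" "q' \<in> P p'"
          and agr: "agree (max m k) p p'" "agree (max m k) q q'"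
          using lim by blast
        obtain t' T' where T': "K p' = Some t'" "rep_tree t' = Some T'" "P p' = paths T'"
          using P[OF p'(1)] by blast
        have "map q' [0..<k] \<in> T'" using p'(2) T'(3) by (simp add: paths_def)
        moreover have "map q' [0..<k] = ?w" using agr(2) by (simp add: agree_def)
        ultimately have "?w \<in> words" "t' (word_code ?w) = 1"
          using mem_rep_tree_iff[OF T'(2), of ?w] by simp_all
        moreover have "t (word_code ?w) = t' (word_code ?w)"
          using m[OF agree_mono[OF agr(1)] T'(1)] by (simp add: agree_def)
        ultimately show ?thesis using mem_rep_tree_iff[OF T(2)] by simp
      qed
      ultimately show ?thesis using T(5) by (simp add: paths_def)
    qed
    fix q i v assume q: "q \<in> P p" and v: "Y p q i = Some v"
    obtain r where r: "H (pair p q) = Some r" using HP[OF p q] by blast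
    with v have "first_letter (row r i) = Some v" by (simp add: Y_def)
    from first_letter_persistent[OF this]
    obtain k where k: "\<And>r'. agree k r r' \<Longrightarrow> first_letter (row r' i) = Some v" by blast
    from computable_continuous[OF H, OF r]
    obtain m where m: "\<forall>s r'. agree m (pair p q) s \<longrightarrow> H s = Some r' \<longrightarrow> agree k r r'" ..
    have "Y p' q' i = Some v"
      if p': "p' \<in> conv_rows" "q' \<in> P p'" and agr: "agree m p p'" "agree m q q'" for p' q'
    proof -
      obtain r' where r': "H (pair p' q') = Some r'" using HP[OF p'] by blast
      then show ?thesis using k[OF m[rule_format, OF agree_pair[OF agr] r']] by (simp add: Y_def)
    qed
    then show "\<exists>m. \<forall>p'\<in>conv_rows. \<forall>q'\<in>P p'. agree m p p' \<longrightarrow> agree m q q' \<longrightarrow> Y p' q' i = Some v"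
      by blast
  qed
  obtain p q where p: "p \<in> conv_rows" and q: "q \<in> P p"
    and wrong: "\<And>i. Y p q i \<in> {None, Some (lim (row p i))}"
    using all_wrong by blast
  obtain r y where r: "H (pair p q) = Some r"
    and y: "rep_seq (rep_completion rep_nat) r = Some y" "y \<in> val (stash NLIM) (row p)"
    using HP[OF p q] by blast
  obtain i where "first_letter (row r i) \<notin> {None, Some (lim (row p i))}"
    using stash_NLIM_outputD[OF y] by blast
  then show False using wrong[of i] r by (simp add: Y_def)
qed

end
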